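(* Let $(F_t)_{t\ge 0}$ be continuous functions $F_t:\mathbb{R}^d\to\mathbb{R}^d$ such that each $F_t$ is Lipschitz with constant $c_t<1$ and all $F_t$ have the same (unique) fixed point $w^*$. Let $(w_t)_{t\ge0}$ be generated, from some chosen initial value $w_0\in\mathbb{R}^d$, by $$w_{t+1}=F_t(w_t)+e_t,\qquad t\ge 0,$$ where $e_t$ is a random noise which may depend on the iteration history, has zero mean conditionally on that history, and satisfies $\|e_t\|\le\alpha_t$. Define $$C_k^2=\sum_{i=0}^{k-1}\alpha_i^2\prod_{j=i+1}^{k-1}c_j^2,\qquad D_k^2=\prod_{i=0}^{k-1}c_i^2 .$$ (i) For every $T\ge 0$, $$\mathbb{E}\left[\|w_T-w^*\|^2\right]\le D_T^2\,\|w_0-w^*\|^2+C_T^2 .\qquad(\star)$$ (ii) There exist a sequence of continuous functions $F_t:\mathbb{R}^d\to\mathbb{R}^d$, $t\ge0$, with each $F_t$ Lipschitz with the given constant $c_t<1$ and all $F_t$ having the same (unique) fixed point $w^*$, and random noise $(e_t)_{t\ge0}$, where $e_t$ may depend on the iteration history, has zero mean conditionally on that history, and satisfies $\|e_t\|\le\alpha_t$ with the given constants $\alpha_t$, for which the sequence generated by $w_{t+1}=F_t(w_t)+e_t$, $t\ge0$, satisfies $(\star)$ with equality. (iii) Suppose in addition that the sequence $(c_t)_{t\ge0}$ is non-decreasing. Then the right-hand side of $(\star)$ converges linearly (to $0$, as $T\to\infty$) if and only if all $c_t$ are bounded above by a constant $c<1$ and $\alpha_t$ converges to $0$ linearly.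
   Context: $\|\cdot\|$ is the Euclidean norm on $\mathbb{R}^d$. Empty sums equal $0$ and empty products equal $1$. A nonnegative sequence $(a_T)$ converges to $0$ linearly if there are constants $C>0$, $M\ge 0$ and $\rho\in(0,1)$ with $a_T\le C\rho^T$ for all $T\ge M$. The constants $\alpha_t\ge 0$ are deterministic.
   Formalization: In (iii) the equivalence is stated when the right-hand side of (⋆) is not eventually zero; otherwise it can fail (w_0=w*, α_t=0, c_t=1−1/(t+2)). The "if" direction, and that linear convergence of the right-hand side forces that of α_t, hold without this restriction. *)

theory Defs
  imports "HOL-Probability.Probability"
begin

text \<open>
  The sigma-algebra generated by the iterates \<open>w 0, \<dots>, w t\<close>. When \<open>w 0\<close> is constant and
  \<open>w (t+1) = F t (w t) + e t\<close> with each \<open>F t\<close> continuous, it is also the one generated by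
  \<open>e 0, \<dots>, e (t-1)\<close>, so the two readings of ``iteration history'' agree.
\<close>

definition history :: "'a measure \<Rightarrow> (nat \<Rightarrow> 'a \<Rightarrow> real^'n) \<Rightarrow> nat \<Rightarrow> 'a measure" where
  "history M w t = sigma (space M) {w i -` A \<inter> space M | i A. i \<le> t \<and> A \<in> sets borel}"

text \<open>The library has conditional expectations of real random variables only.\<close>

definition vec_cond_exp :: "'a measure \<Rightarrow> 'a measure \<Rightarrow> ('a \<Rightarrow> real^'n) \<Rightarrow> 'a \<Rightarrow> real^'n" where
  "vec_cond_exp M G f \<omega> = (\<chi> i. real_cond_exp M G (\<lambda>\<omega>. f \<omega> $ i) \<omega>)"

locale noisy_iteration = prob_space M
  for M :: "'a measure" +
  fixes F :: "nat \<Rightarrow> real^'n \<Rightarrow> real^'n"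
    and c \<alpha> :: "nat \<Rightarrow> real"
    and wstar w0 :: "real^'n"
    and e w :: "nat \<Rightarrow> 'a \<Rightarrow> real^'n"
  assumes F_continuous: "continuous_on UNIV (F t)"
    and F_lipschitz: "(c t)-lipschitz_on UNIV (F t)"
    and F_fixpoint: "F t v = v \<longleftrightarrow> v = wstar"
    and w_0: "\<omega> \<in> space M \<Longrightarrow> w 0 \<omega> = w0"
    and w_Suc: "\<omega> \<in> space M \<Longrightarrow> w (Suc t) \<omega> = F t (w t \<omega>) + e t \<omega>"
    and e_measurable: "e t \<in> borel_measurable M"
    and e_bounded: "AE \<omega> in M. norm (e t \<omega>) \<le> \<alpha> t"
    and e_mean_zero: "AE \<omega> in M. vec_cond_exp M (history M w t) (e t) \<omega> = 0"

text \<open>\<open>C2 c \<alpha> k\<close> and \<open>D2 c k\<close> are the squares $C_k^2$ and $D_k^2$.\<close>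

definition C2 :: "(nat \<Rightarrow> real) \<Rightarrow> (nat \<Rightarrow> real) \<Rightarrow> nat \<Rightarrow> real" where
  "C2 c \<alpha> k = (\<Sum>i<k. (\<alpha> i)\<^sup>2 * (\<Prod>j=i+1..<k. (c j)\<^sup>2))"

definition D2 :: "(nat \<Rightarrow> real) \<Rightarrow> nat \<Rightarrow> real" where
  "D2 c k = (\<Prod>i<k. (c i)\<^sup>2)"

text \<open>
  This bound vanishes from some index on in degenerate cases: \<open>\<alpha>\<close> is identically zero and
  \<open>w0 = wstar\<close> or \<open>c 0 = 0\<close>, for instance. It then converges linearly even if \<open>c\<close> tends to 1,
  so linear convergence can force \<open>c\<close> to stay away from 1 only when the bound is not eventually
  zero.
\<close>

definition error_bound ::
  "(nat \<Rightarrow> real) \<Rightarrow> (nat \<Rightarrow> real) \<Rightarrow> real^'n \<Rightarrow> real^'n \<Rightarrow> nat \<Rightarrow> real" where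
  "error_bound c \<alpha> wstar w0 T = D2 c T * (norm (w0 - wstar))\<^sup>2 + C2 c \<alpha> T"

definition converges_linearly :: "(nat \<Rightarrow> real) \<Rightarrow> bool" where
  "converges_linearly a \<longleftrightarrow> (\<forall>T. 0 \<le> a T) \<and>
     (\<exists>C>0. \<exists>M. \<exists>\<rho>. 0 < \<rho> \<and> \<rho> < 1 \<and> (\<forall>T\<ge>M. a T \<le> C * \<rho> ^ T))"

end

theory Submission
  imports Defs
begin

text \<open>
  Conditionally on the history the noise is orthogonal to \<open>F T (w T) - wstar\<close>, so the mean squared
  error \<open>E\<close> splits by Pythagoras; contraction then gives \<open>E (T + 1) \<le> (c T)\<^sup>2 * E T + (\<alpha> T)\<^sup>2\<close>, and
  the bound satisfies this recursion with equality. The bound is attained by the homotheties with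
  ratio \<open>c t\<close> around \<open>wstar\<close>, perturbed by independent random signs times a vector of length
  \<open>\<alpha> t\<close>. If \<open>c\<close> is non-decreasing and not bounded away from 1, then for every \<open>r < 1\<close> the bound
  eventually shrinks by no more than the factor \<open>r\<close> per step, so once nonzero it is not linearly
  convergent.
\<close>

section \<open>Iteration histories\<close>

lemma space_history [simp]: "space (history M w t) = space M"
  unfolding history_def by (rule space_measure_of) auto

lemma sets_history:
  "sets (history M w t) =
     sigma_sets (space M) {w i -` A \<inter> space M | i A. i \<le> t \<and> A \<in> sets borel}"
  unfolding history_def by (rule sets_measure_of) auto

lemma measurable_history:
  fixes w :: "nat \<Rightarrow> 'a \<Rightarrow> real^'n"
  assumes "i \<le> t"
  shows "w i \<in> borel_measurable (history M w t)"
proof (rule measurableI)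
  fix A :: "(real^'n) set" assume "A \<in> sets borel"
  then show "w i -` A \<inter> space (history M w t) \<in> sets (history M w t)"
    using assms unfolding sets_history by (auto intro!: sigma_sets.Basic)
qed simp

lemma subalgebra_history:
  assumes "\<And>i. i \<le> t \<Longrightarrow> w i \<in> borel_measurable M"
  shows "subalgebra M (history M w t)"
  unfolding subalgebra_def
proof
  have "sigma_sets (space M) {w i -` A \<inter> space M | i A. i \<le> t \<and> A \<in> sets borel} \<subseteq> sets M"
    by (rule sets.sigma_sets_subset) (auto intro: measurable_sets assms)
  then show "sets (history M w t) \<subseteq> sets M"
    by (simp add: sets_history)
qed simp

text \<open>The sets that \<open>\<phi>\<close> neither enters nor leaves form a sigma-algebra,
  which contains the generators because \<open>w 0\<close>, ..., \<open>w t\<close> do not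
  distinguish \<open>\<omega>\<close> from \<open>\<phi> \<omega>\<close>.\<close>

lemma history_invariant:
  assumes \<phi>: "\<And>\<omega>. \<omega> \<in> space M \<Longrightarrow> \<phi> \<omega> \<in> space M"
    and w: "\<And>i \<omega>. i \<le> t \<Longrightarrow> \<omega> \<in> space M \<Longrightarrow> w i (\<phi> \<omega>) = w i \<omega>"
    and A: "A \<in> sets (history M w t)" and \<omega>: "\<omega> \<in> space M"
  shows "\<phi> \<omega> \<in> A \<longleftrightarrow> \<omega> \<in> A"
  using A unfolding sets_history
proof induction
  case (Basic a)
  then show ?case using \<phi>[OF \<omega>] w[OF _ \<omega>] \<omega> by auto
next
  case (Compl a)
  then show ?case using \<phi>[OF \<omega>] \<omega> by auto
qed auto

section \<open>Conditionally centred noise\<close>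

lemma borel_measurable_vec_nth: "(\<lambda>x::real^'n. x $ i) \<in> borel_measurable borel"
  by (intro borel_measurable_continuous_onI continuous_intros)

text \<open>In each coordinate the \<open>G\<close>-measurable factor \<open>Z\<close> can be pulled
  out of the conditional expectation, which leaves an integral of 0. The two bounds make the
  products integrable.\<close>

lemma (in prob_space) integral_inner_cond_exp_zero:
  fixes X Z :: "'a \<Rightarrow> real^'n"
  assumes G: "subalgebra M G"
    and Z: "Z \<in> borel_measurable G" and Zb: "AE \<omega> in M. norm (Z \<omega>) \<le> K"
    and X: "X \<in> borel_measurable M" and Xb: "AE \<omega> in M. norm (X \<omega>) \<le> L"
    and zero: "AE \<omega> in M. vec_cond_exp M G X \<omega> = 0"
  shows "(\<integral>\<omega>. Z \<omega> \<bullet> X \<omega> \<partial>M) = 0"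
proof -
  interpret G: sigma_finite_subalgebra M G
    by (intro finite_measure_subalgebra_is_sigma_finite finite_measure_subalgebra.intro
        finite_measure_subalgebra_axioms.intro G) unfold_locales
  have Z': "Z \<in> borel_measurable M"
    by (rule measurable_from_subalg[OF G Z])
  have comp: "integrable M (\<lambda>\<omega>. Z \<omega> $ i * X \<omega> $ i) \<and> (\<integral>\<omega>. Z \<omega> $ i * X \<omega> $ i \<partial>M) = 0" for i
  proof
    have [measurable]: "(\<lambda>\<omega>. Z \<omega> $ i) \<in> borel_measurable G" "(\<lambda>\<omega>. X \<omega> $ i) \<in> borel_measurable M"
      "(\<lambda>\<omega>. Z \<omega> $ i) \<in> borel_measurable M"
      using X Z Z' by (auto intro: measurable_compose[OF _ borel_measurable_vec_nth])
    show int: "integrable M (\<lambda>\<omega>. Z \<omega> $ i * X \<omega> $ i)"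
    proof (rule integrable_const_bound)
      show "AE \<omega> in M. norm (Z \<omega> $ i * X \<omega> $ i) \<le> K * L"
        using Zb Xb
      proof eventually_elim
        case (elim \<omega>)
        have "\<bar>Z \<omega> $ i\<bar> \<le> K" "\<bar>X \<omega> $ i\<bar> \<le> L"
          using elim component_le_norm_cart[of "Z \<omega>" i] component_le_norm_cart[of "X \<omega>" i] by auto
        then show ?case
          by (auto simp: abs_mult intro!: mult_mono)
      qed
    qed measurable
    have "(\<integral>\<omega>. Z \<omega> $ i * X \<omega> $ i \<partial>M) = (\<integral>\<omega>. Z \<omega> $ i * real_cond_exp M G (\<lambda>\<omega>. X \<omega> $ i) \<omega> \<partial>M)"
      by (rule G.real_cond_exp_intg(2)[symmetric]) (use int in measurable)
    also have "\<dots> = (\<integral>\<omega>. 0 \<partial>M)"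
    proof (rule integral_cong_AE)
      show "AE \<omega> in M. Z \<omega> $ i * real_cond_exp M G (\<lambda>\<omega>. X \<omega> $ i) \<omega> = 0"
        using zero by eventually_elim (auto simp: vec_cond_exp_def vec_eq_iff)
    qed measurable
    finally show "(\<integral>\<omega>. Z \<omega> $ i * X \<omega> $ i \<partial>M) = 0" by simp
  qed
  then show ?thesis
    by (simp add: inner_vec_def Bochner_Integration.integral_sum)
qed

text \<open>
  Independence of the noise from the past enters only through a measure-preserving map that fixes
  the past and reverses the noise.
\<close>

lemma (in prob_space) vec_cond_exp_history_zero:
  fixes X :: "'a \<Rightarrow> real^'n"
  assumes w: "\<And>i. i \<le> t \<Longrightarrow> w i \<in> borel_measurable M"
    and X: "integrable M X"
    and \<phi>: "\<phi> \<in> measurable M M" "distr M M \<phi> = M"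
    and w\<phi>: "\<And>i \<omega>. i \<le> t \<Longrightarrow> \<omega> \<in> space M \<Longrightarrow> w i (\<phi> \<omega>) = w i \<omega>"
    and X\<phi>: "\<And>\<omega>. \<omega> \<in> space M \<Longrightarrow> X (\<phi> \<omega>) = - X \<omega>"
  shows "AE \<omega> in M. vec_cond_exp M (history M w t) X \<omega> = 0"
proof -
  let ?G = "history M w t"
  have G: "subalgebra M ?G"
    by (rule subalgebra_history[OF w])
  interpret G: sigma_finite_subalgebra M ?G
    by (intro finite_measure_subalgebra_is_sigma_finite finite_measure_subalgebra.intro
        finite_measure_subalgebra_axioms.intro G) unfold_locales
  have "AE \<omega> in M. real_cond_exp M ?G (\<lambda>\<omega>. X \<omega> $ i) \<omega> = 0" for i
  proof (rule G.real_cond_exp_charact)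
    fix A assume A: "A \<in> sets ?G"
    then have [measurable]: "A \<in> sets M"
      using G by (auto simp: subalgebra_def)
    have [measurable]: "(\<lambda>\<omega>. X \<omega> $ i) \<in> borel_measurable M"
      using borel_measurable_integrable[OF X] by (rule measurable_compose[OF _ borel_measurable_vec_nth])
    let ?f = "\<lambda>\<omega>. indicator A \<omega> *\<^sub>R X \<omega> $ i"
    \<comment> \<open>Substituting \<open>\<phi>\<close> keeps the event \<open>A\<close> and
      reverses \<open>X\<close>, so the integral over \<open>A\<close> equals its own
      negative.\<close>
    have "(\<integral>\<omega>. ?f \<omega> \<partial>M) = (\<integral>\<omega>. ?f \<omega> \<partial>distr M M \<phi>)"
      using \<phi> by simp
    also have "\<dots> = (\<integral>\<omega>. ?f (\<phi> \<omega>) \<partial>M)"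
      by (rule integral_distr[OF \<phi>(1)]) measurable
    also have "\<dots> = (\<integral>\<omega>. - ?f \<omega> \<partial>M)"
    proof (rule Bochner_Integration.integral_cong[OF refl])
      fix \<omega> assume \<omega>: "\<omega> \<in> space M"
      have "\<phi> \<omega> \<in> A \<longleftrightarrow> \<omega> \<in> A"
        by (rule history_invariant[OF _ w\<phi> A \<omega>]) (auto intro: measurable_space[OF \<phi>(1)])
      then show "?f (\<phi> \<omega>) = - ?f \<omega>"
        using X\<phi>[OF \<omega>] by (simp add: indicator_def)
    qed
    finally show "(\<integral>\<omega>\<in>A. X \<omega> $ i \<partial>M) = (\<integral>\<omega>\<in>A. 0 \<partial>M)"
      by (simp add: set_lebesgue_integral_def)
  next
    show "integrable M (\<lambda>\<omega>. X \<omega> $ i)"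
      by (rule integrable_bounded_linear[OF bounded_linear_vec_nth X])
  qed auto
  then have "AE \<omega> in M. \<forall>i. real_cond_exp M ?G (\<lambda>\<omega>. X \<omega> $ i) \<omega> = 0"
    by (simp add: AE_all_countable)
  then show ?thesis
    by eventually_elim (simp add: vec_cond_exp_def vec_eq_iff)
qed

section \<open>The mean squared error\<close>

lemma error_bound_0 [simp]: "error_bound c \<alpha> wstar w0 0 = (norm (w0 - wstar))\<^sup>2"
  by (simp add: error_bound_def D2_def C2_def)

text \<open>Passing from \<open>T\<close> to \<open>Suc T\<close> multiplies every old term by
  \<open>(c T)\<^sup>2\<close> and adds a term with \<open>i = T\<close>, whose product is empty.
  Later arguments use this recursion instead of the closed form.\<close>

lemma error_bound_Suc:
  "error_bound c \<alpha> wstar w0 (Suc T) = (c T)\<^sup>2 * error_bound c \<alpha> wstar w0 T + (\<alpha> T)\<^sup>2"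
proof -
  have "(\<Sum>i<T. (\<alpha> i)\<^sup>2 * (\<Prod>j=i+1..<Suc T. (c j)\<^sup>2)) =
        (\<Sum>i<T. (c T)\<^sup>2 * ((\<alpha> i)\<^sup>2 * (\<Prod>j=i+1..<T. (c j)\<^sup>2)))"
    by (rule sum.cong) (auto simp: prod.atLeastLessThan_Suc)
  then have "C2 c \<alpha> (Suc T) = (c T)\<^sup>2 * C2 c \<alpha> T + (\<alpha> T)\<^sup>2"
    by (simp add: C2_def sum_distrib_left)
  then show ?thesis
    by (simp add: error_bound_def D2_def algebra_simps)
qed

lemma error_bound_nonneg: "0 \<le> error_bound c \<alpha> wstar w0 T"
  by (induction T) (auto simp: error_bound_Suc)

lemma (in prob_space) integrable_norm_power2:
  fixes X :: "'a \<Rightarrow> real^'n"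
  assumes [measurable]: "X \<in> borel_measurable M" and K: "AE \<omega> in M. norm (X \<omega>) \<le> K"
  shows "integrable M (\<lambda>\<omega>. (norm (X \<omega>))\<^sup>2)"
proof (rule integrable_const_bound)
  show "AE \<omega> in M. norm ((norm (X \<omega>))\<^sup>2) \<le> K\<^sup>2"
    using K by eventually_elim (auto intro: power_mono)
qed measurable

context noisy_iteration
begin

section \<open>Measurability, boundedness and integrability along the iteration\<close>

lemma w_measurable: "w t \<in> borel_measurable M"
proof (induction t)
  case 0
  then show ?case
    by (subst measurable_cong[where g = "\<lambda>_. w0"]) (auto simp: w_0)
next
  case (Suc t)
  have "(\<lambda>\<omega>. F t (w t \<omega>)) \<in> borel_measurable M"
    by (rule measurable_compose[OF Suc borel_measurable_continuous_onI[OF F_continuous]])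
  then have "(\<lambda>\<omega>. F t (w t \<omega>) + e t \<omega>) \<in> borel_measurable M"
    using e_measurable by measurable
  then show ?case
    by (subst measurable_cong[where g = "\<lambda>\<omega>. F t (w t \<omega>) + e t \<omega>"]) (auto simp: w_Suc)
qed

lemma F_contracts: "norm (F t v - wstar) \<le> c t * norm (v - wstar)"
  using lipschitz_onD[OF F_lipschitz, of v wstar t] F_fixpoint[of t wstar]
  by (simp add: dist_norm)

text \<open>This provides the integrability of all squares below and, through
  \<open>F_bounded\<close>, the bound needed to remove the cross term. It holds only almost
  everywhere because the noise is bounded only there.\<close>

lemma w_bounded: "\<exists>K. AE \<omega> in M. norm (w t \<omega> - wstar) \<le> K"
proof (induction t)
  case 0
  then show ?case
    by (intro exI[of _ "norm (w0 - wstar)"]) (simp add: w_0)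
next
  case (Suc t)
  then obtain K where K: "AE \<omega> in M. norm (w t \<omega> - wstar) \<le> K" by blast
  have "AE \<omega> in M. norm (w (Suc t) \<omega> - wstar) \<le> c t * K + \<alpha> t"
    using K e_bounded[of t] AE_space
  proof eventually_elim
    case (elim \<omega>)
    have "w (Suc t) \<omega> - wstar = (F t (w t \<omega>) - wstar) + e t \<omega>"
      using elim by (simp add: w_Suc)
    then have "norm (w (Suc t) \<omega> - wstar) \<le> norm (F t (w t \<omega>) - wstar) + norm (e t \<omega>)"
      by (metis norm_triangle_ineq)
    also have "\<dots> \<le> c t * norm (w t \<omega> - wstar) + \<alpha> t"
      using F_contracts elim by (intro add_mono) auto
    \<comment> \<open>Nonnegativity of \<open>c t\<close> is not a locale assumption; it is part of
      being a Lipschitz constant.\<close>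
    also have "\<dots> \<le> c t * K + \<alpha> t"
      using elim lipschitz_on_nonneg[OF F_lipschitz] by (intro add_mono mult_left_mono) auto
    finally show ?case .
  qed
  then show ?case ..
qed

lemma integrable_error: "integrable M (\<lambda>\<omega>. (norm (w t \<omega> - wstar))\<^sup>2)"
proof -
  obtain K where "AE \<omega> in M. norm (w t \<omega> - wstar) \<le> K" using w_bounded by blast
  with w_measurable show ?thesis by (intro integrable_norm_power2) auto
qed

lemma F_measurable: "(\<lambda>\<omega>. F t (w t \<omega>)) \<in> borel_measurable M"
  by (rule measurable_compose[OF w_measurable borel_measurable_continuous_onI[OF F_continuous]])

lemma F_bounded: "\<exists>K. AE \<omega> in M. norm (F t (w t \<omega>) - wstar) \<le> K"
proof -
  obtain K where "AE \<omega> in M. norm (w t \<omega> - wstar) \<le> K" using w_bounded by blast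
  then have "AE \<omega> in M. norm (F t (w t \<omega>) - wstar) \<le> c t * K"
    by eventually_elim
      (meson F_contracts F_lipschitz lipschitz_on_nonneg mult_left_mono order_trans)
  then show ?thesis ..
qed

lemma integrable_F_error: "integrable M (\<lambda>\<omega>. (norm (F t (w t \<omega>) - wstar))\<^sup>2)"
proof -
  obtain K where "AE \<omega> in M. norm (F t (w t \<omega>) - wstar) \<le> K" using F_bounded by blast
  with F_measurable show ?thesis by (intro integrable_norm_power2) auto
qed

lemma integrable_noise: "integrable M (\<lambda>\<omega>. (norm (e t \<omega>))\<^sup>2)"
  by (rule integrable_norm_power2[OF e_measurable e_bounded])

section \<open>Evolution of the mean squared error\<close>

lemma error_0: "(\<integral>\<omega>. (norm (w 0 \<omega> - wstar))\<^sup>2 \<partial>M) = (norm (w0 - wstar))\<^sup>2"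
proof -
  have "(\<integral>\<omega>. (norm (w 0 \<omega> - wstar))\<^sup>2 \<partial>M) = (\<integral>\<omega>. (norm (w0 - wstar))\<^sup>2 \<partial>M)"
    by (rule Bochner_Integration.integral_cong) (auto simp: w_0)
  then show ?thesis by (simp add: prob_space)
qed

text \<open>Expanding the square leaves a cross term between \<open>e t\<close> and
  \<open>F t (w t) - wstar\<close>. The latter is bounded and history-measurable, so the cross term
  integrates to 0.\<close>

lemma error_Suc:
  "(\<integral>\<omega>. (norm (w (Suc t) \<omega> - wstar))\<^sup>2 \<partial>M) =
     (\<integral>\<omega>. (norm (F t (w t \<omega>) - wstar))\<^sup>2 \<partial>M) + (\<integral>\<omega>. (norm (e t \<omega>))\<^sup>2 \<partial>M)"
proof -
  let ?Z = "\<lambda>\<omega>. F t (w t \<omega>) - wstar"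
  have expand: "(norm (w (Suc t) \<omega> - wstar))\<^sup>2 =
      (norm (?Z \<omega>))\<^sup>2 + (norm (e t \<omega>))\<^sup>2 + 2 * (?Z \<omega> \<bullet> e t \<omega>)" if "\<omega> \<in> space M" for \<omega>
  proof -
    have "w (Suc t) \<omega> - wstar = ?Z \<omega> + e t \<omega>"
      using that by (simp add: w_Suc)
    then show ?thesis
      by (simp only: power2_norm_eq_inner) (simp add: inner_add inner_commute)
  qed
  \<comment> \<open>Solving the expansion for the cross term exhibits it as a combination of three
    integrable squares.\<close>
  have int: "integrable M (\<lambda>\<omega>. 2 * (?Z \<omega> \<bullet> e t \<omega>))"
  proof (subst Bochner_Integration.integrable_cong[OF refl])
    show "2 * (?Z \<omega> \<bullet> e t \<omega>) =
        (norm (w (Suc t) \<omega> - wstar))\<^sup>2 - (norm (?Z \<omega>))\<^sup>2 - (norm (e t \<omega>))\<^sup>2" if "\<omega> \<in> space M" for \<omega>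
      using expand[OF that] by simp
  qed (intro Bochner_Integration.integrable_diff integrable_error integrable_F_error integrable_noise)
  have "?Z \<in> borel_measurable (history M w t)"
  proof -
    have "(\<lambda>\<omega>. F t (w t \<omega>)) \<in> borel_measurable (history M w t)"
      by (rule measurable_compose[OF measurable_history[OF order_refl]
            borel_measurable_continuous_onI[OF F_continuous]])
    then show ?thesis by measurable
  qed
  moreover obtain K where "AE \<omega> in M. norm (?Z \<omega>) \<le> K" using F_bounded by blast
  ultimately have cross: "(\<integral>\<omega>. ?Z \<omega> \<bullet> e t \<omega> \<partial>M) = 0"
    by (rule integral_inner_cond_exp_zero[OF subalgebra_history[OF w_measurable] _ _
          e_measurable e_bounded e_mean_zero])
  have "(\<integral>\<omega>. (norm (w (Suc t) \<omega> - wstar))\<^sup>2 \<partial>M) =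
      (\<integral>\<omega>. (norm (?Z \<omega>))\<^sup>2 + (norm (e t \<omega>))\<^sup>2 + 2 * (?Z \<omega> \<bullet> e t \<omega>) \<partial>M)"
    by (rule Bochner_Integration.integral_cong[OF refl expand])
  also have "\<dots> = (\<integral>\<omega>. (norm (?Z \<omega>))\<^sup>2 \<partial>M) + (\<integral>\<omega>. (norm (e t \<omega>))\<^sup>2 \<partial>M)
      + (\<integral>\<omega>. 2 * (?Z \<omega> \<bullet> e t \<omega>) \<partial>M)"
    using int integrable_F_error integrable_noise by simp
  finally show ?thesis using cross by simp
qed

lemma error_le: "(\<integral>\<omega>. (norm (w T \<omega> - wstar))\<^sup>2 \<partial>M) \<le> error_bound c \<alpha> wstar w0 T"
proof (induction T)
  case 0
  then show ?case by (simp add: error_0)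
next
  case (Suc T)
  have "(\<integral>\<omega>. (norm (F T (w T \<omega>) - wstar))\<^sup>2 \<partial>M) \<le> (\<integral>\<omega>. (c T)\<^sup>2 * (norm (w T \<omega> - wstar))\<^sup>2 \<partial>M)"
    using F_contracts
    by (intro integral_mono integrable_F_error Bochner_Integration.integrable_mult_right
        integrable_error) (auto simp flip: power_mult_distrib intro!: power_mono)
  also have "\<dots> \<le> (c T)\<^sup>2 * error_bound c \<alpha> wstar w0 T"
    using Suc by (simp add: mult_left_mono)
  finally have 1: "(\<integral>\<omega>. (norm (F T (w T \<omega>) - wstar))\<^sup>2 \<partial>M) \<le> (c T)\<^sup>2 * error_bound c \<alpha> wstar w0 T" .
  have "(\<integral>\<omega>. (norm (e T \<omega>))\<^sup>2 \<partial>M) \<le> (\<integral>\<omega>. (\<alpha> T)\<^sup>2 \<partial>M)"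
  proof (rule integral_mono_AE[OF integrable_noise])
    show "AE \<omega> in M. (norm (e T \<omega>))\<^sup>2 \<le> (\<alpha> T)\<^sup>2"
      using e_bounded by eventually_elim (auto intro: power_mono)
  qed simp
  with 1 show ?case
    by (simp add: error_Suc error_bound_Suc prob_space)
qed

text \<open>Under these assumptions the two estimates in \<open>error_le\<close>, contraction and
  noise size, are equalities at every step.\<close>

lemma error_eq:
  assumes F: "\<And>t v. norm (F t v - wstar) = c t * norm (v - wstar)"
    and e: "\<And>t \<omega>. \<omega> \<in> space M \<Longrightarrow> norm (e t \<omega>) = \<alpha> t"
  shows "(\<integral>\<omega>. (norm (w T \<omega> - wstar))\<^sup>2 \<partial>M) = error_bound c \<alpha> wstar w0 T"
proof (induction T)
  case 0
  then show ?case by (simp add: error_0)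
next
  case (Suc T)
  have "(\<integral>\<omega>. (norm (e T \<omega>))\<^sup>2 \<partial>M) = (\<integral>\<omega>. (\<alpha> T)\<^sup>2 \<partial>M)"
    by (rule Bochner_Integration.integral_cong) (auto simp: e)
  with Suc show ?case
    by (simp add: error_Suc error_bound_Suc prob_space F power_mult_distrib)
qed

end

section \<open>Sharpness\<close>

text \<open>A product measure is determined by its values on cylinders over finitely many
  coordinates, and there only the factor at \<open>t\<close> changes, to a set of the same
  measure.\<close>

lemma distr_PiM_fun_upd:
  assumes N: "\<And>i. prob_space (N i)" and t: "t \<in> I"
    and g: "g \<in> measurable (N t) (N t)" "distr (N t) (N t) g = N t"
  shows "(\<lambda>\<omega>. fun_upd \<omega> t (g (\<omega> t))) \<in> measurable (PiM I N) (PiM I N)"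
    and "distr (PiM I N) (PiM I N) (\<lambda>\<omega>. fun_upd \<omega> t (g (\<omega> t))) = PiM I N"
proof -
  interpret N: prob_space "N i" for i by (rule N)
  interpret product_prob_space N I ..
  let ?\<phi> = "\<lambda>\<omega>. fun_upd \<omega> t (g (\<omega> t))"
  have "(\<lambda>\<omega>. g (\<omega> t)) \<in> measurable (PiM I N) (N t)"
    by (rule measurable_compose[of "\<lambda>\<omega>. \<omega> t" _ "N t"]) (use t g in auto)
  then show \<phi>: "?\<phi> \<in> measurable (PiM I N) (PiM I N)"
    using t by (intro measurable_fun_upd[where J = I]) auto
  show "distr (PiM I N) (PiM I N) ?\<phi> = PiM I N"
  proof (rule PiM_eq)
    fix J A assume J: "finite J" "J \<subseteq> I" and A: "\<And>j. j \<in> J \<Longrightarrow> A j \<in> sets (N j)"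
    \<comment> \<open>These are the sides of the preimage cylinder.\<close>
    define B where "B j = (if j = t then g -` A t \<inter> space (N t) else A j)" for j
    have B: "B j \<in> sets (N j)" if "j \<in> J" for j
      using A[OF that] that measurable_sets[OF g(1), of "A t"] by (auto simp: B_def)
    have eq: "?\<phi> -` prod_emb I N J (\<Pi>\<^sub>E j\<in>J. A j) \<inter> space (PiM I N) =
        prod_emb I N J (\<Pi>\<^sub>E j\<in>J. B j)"
    proof (intro set_eqI)
      fix \<omega>
      show "\<omega> \<in> ?\<phi> -` prod_emb I N J (\<Pi>\<^sub>E j\<in>J. A j) \<inter> space (PiM I N) \<longleftrightarrow>
          \<omega> \<in> prod_emb I N J (\<Pi>\<^sub>E j\<in>J. B j)"
      proof (cases "\<omega> \<in> space (PiM I N)")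
        case True
        then have "?\<phi> \<omega> \<in> space (PiM I N)"
          by (rule measurable_space[OF \<phi>])
        moreover have "\<omega> t \<in> space (N t)"
          using True t by (auto simp: space_PiM)
        ultimately show ?thesis
          using True J by (auto simp: prod_emb_def space_PiM PiE_iff B_def split: if_splits)
      next
        case False
        then show ?thesis
          by (auto simp: prod_emb_def space_PiM)
      qed
    qed
    have "emeasure (N j) (B j) = emeasure (N j) (A j)" if "j \<in> J" for j
      using emeasure_distr[OF g(1), of "A j"] A[OF that] g(2) by (auto simp: B_def)
    then show "emeasure (distr (PiM I N) (PiM I N) ?\<phi>) (prod_emb I N J (\<Pi>\<^sub>E j\<in>J. A j)) =
        (\<Prod>j\<in>J. emeasure (N j) (A j))"
      using J A B \<phi> by (simp add: emeasure_distr eq emeasure_PiM_emb sets_PiM_I)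
  qed simp
qed

abbreviation rademacher_sequence :: "(nat \<Rightarrow> real) measure" where
  "rademacher_sequence \<equiv> PiM UNIV (\<lambda>_. measure_pmf (pmf_of_set {-1, 1}))"

text \<open>
  The space of this measure also contains sequences with entries other than \<open>-1\<close> and \<open>1\<close>; unlike
  negation, this flip reverses the comparison with 0 on all of them.
\<close>

definition flip :: "real \<Rightarrow> real" where
  "flip x = (if x > 0 then -1 else 1)"

text \<open>\<open>flip\<close> swaps the two equally likely values, so it preserves the law of a
  single coordinate.\<close>

lemma rademacher_sequence_flip:
  "(\<lambda>\<omega>. fun_upd \<omega> t (flip (\<omega> t))) \<in> measurable rademacher_sequence rademacher_sequence"
  "distr rademacher_sequence rademacher_sequence (\<lambda>\<omega>. fun_upd \<omega> t (flip (\<omega> t))) = rademacher_sequence"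
proof -
  let ?p = "pmf_of_set {-1, 1 :: real}"
  have "map_pmf flip ?p = pmf_of_set (flip ` {-1, 1})"
    by (rule map_pmf_of_set_inj) (auto simp: flip_def)
  also have "flip ` {-1, 1} = {-1, 1}"
    by (auto simp: flip_def)
  finally have "map_pmf flip ?p = ?p" .
  \<comment> \<open>\<open>map_pmf\<close> pushes forward to a counting space; only the target
    measure has to be exchanged for one with the same measurable sets.\<close>
  moreover have "distr (measure_pmf ?p) (measure_pmf ?p) flip = measure_pmf (map_pmf flip ?p)"
    unfolding map_pmf_rep_eq by (rule distr_cong) auto
  ultimately have "distr (measure_pmf ?p) (measure_pmf ?p) flip = measure_pmf ?p"
    by simp
  note * = distr_PiM_fun_upd[of "\<lambda>_. measure_pmf ?p" t UNIV flip, OF _ _ _ this]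
  show "(\<lambda>\<omega>. fun_upd \<omega> t (flip (\<omega> t))) \<in> measurable rademacher_sequence rademacher_sequence"
    "distr rademacher_sequence rademacher_sequence (\<lambda>\<omega>. fun_upd \<omega> t (flip (\<omega> t))) = rademacher_sequence"
    using * by (auto simp: measure_pmf.prob_space_axioms)
qed

text \<open>Besides the iteration itself, the two exact norm identities are exported, since
  \<open>error_eq\<close> requires them.\<close>

lemma sharp_noisy_iteration:
  fixes c \<alpha> :: "nat \<Rightarrow> real" and wstar w0 :: "real^'n"
  assumes c: "\<And>t. 0 \<le> c t \<and> c t < 1" and \<alpha>: "\<And>t. 0 \<le> \<alpha> t"
  obtains M :: "(nat \<Rightarrow> real) measure" and F e w where
    "noisy_iteration M F c \<alpha> wstar w0 e w"
    "\<And>t v. norm (F t v - wstar) = c t * norm (v - wstar)"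
    "\<And>t \<omega>. norm (e t \<omega>) = \<alpha> t"
proof -
  obtain u :: "real^'n" where u: "norm u = 1"
    using vector_choose_size[of 1] by auto
  define F where "F t v = wstar + c t *\<^sub>R (v - wstar)" for t v
  \<comment> \<open>Reading the sign from a comparison with 0 gives length exactly
    \<open>\<alpha> t\<close> at every point, also where a coordinate is neither -1 nor 1.\<close>
  define e where "e t \<omega> = (if \<omega> t > 0 then \<alpha> t else - \<alpha> t) *\<^sub>R u" for t and \<omega> :: "nat \<Rightarrow> real"
  define w where "w t \<omega> = rec_nat w0 (\<lambda>t v. F t v + e t \<omega>) t" for t \<omega>
  interpret prob_space rademacher_sequence
    by (intro prob_space_PiM measure_pmf.prob_space_axioms)
  have F_norm: "norm (F t v - wstar) = c t * norm (v - wstar)" for t v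
    using c by (simp add: F_def)
  have e_norm: "norm (e t \<omega>) = \<alpha> t" for t \<omega>
    using u \<alpha> by (simp add: e_def)
  have w_Suc: "w (Suc t) \<omega> = F t (w t \<omega>) + e t \<omega>" for t \<omega>
    by (simp add: w_def)
  have e_meas: "e t \<in> borel_measurable rademacher_sequence" for t
  proof -
    have "(\<lambda>\<omega>. (\<lambda>x. (if x > 0 then \<alpha> t else - \<alpha> t) *\<^sub>R u) (\<omega> t)) \<in> borel_measurable rademacher_sequence"
      by (rule measurable_compose[of "\<lambda>\<omega>. \<omega> t" _ "measure_pmf (pmf_of_set {-1, 1})"])
        (auto intro: measurable_component_singleton)
    then show ?thesis by (simp add: e_def [abs_def])
  qed
  have F_cont: "continuous_on UNIV (F t)" for t
    unfolding F_def by (intro continuous_intros)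
  have w_meas: "w t \<in> borel_measurable rademacher_sequence" for t
  proof (induction t)
    case 0
    then show ?case by (simp add: w_def [abs_def])
  next
    case (Suc t)
    have "(\<lambda>\<omega>. F t (w t \<omega>)) \<in> borel_measurable rademacher_sequence"
      by (rule measurable_compose[OF Suc borel_measurable_continuous_onI[OF F_cont]])
    then show ?case
      using e_meas[of t] unfolding w_Suc [abs_def] by (rule borel_measurable_add)
  qed
  \<comment> \<open>The iterate \<open>w i\<close> depends only on the coordinates below
    \<open>i\<close>, so coordinate \<open>t\<close> does not affect it even for
    \<open>i = t\<close>.\<close>
  have w_past: "w i (fun_upd \<omega> t x) = w i \<omega>" if "i \<le> t" for i t \<omega> x
    using that by (induction i) (auto simp: w_Suc e_def, simp add: w_def)
  have "noisy_iteration rademacher_sequence F c \<alpha> wstar w0 e w"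
  proof (unfold_locales)
    fix t
    show "continuous_on UNIV (F t)" by (rule F_cont)
    show "(c t)-lipschitz_on UNIV (F t)"
      using c by (intro lipschitz_onI) (auto simp: F_def dist_norm simp flip: scaleR_diff_right)
    show "F t v = v \<longleftrightarrow> v = wstar" for v
    proof
      assume "F t v = v"
      then have "norm (v - wstar) = c t * norm (v - wstar)"
        using F_norm[of t v] by simp
      then show "v = wstar"
        using c[of t] by auto
    qed (simp add: F_def)
    show "w 0 \<omega> = w0" for \<omega>
      by (simp add: w_def)
    show "w (Suc t) \<omega> = F t (w t \<omega>) + e t \<omega>" for \<omega>
      by (rule w_Suc)
    show "e t \<in> borel_measurable rademacher_sequence"
      by (rule e_meas)
    show "AE \<omega> in rademacher_sequence. norm (e t \<omega>) \<le> \<alpha> t"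
      by (simp add: e_norm)
    show "AE \<omega> in rademacher_sequence. vec_cond_exp rademacher_sequence
        (history rademacher_sequence w t) (e t) \<omega> = 0"
    \<comment> \<open>Flipping coordinate \<open>t\<close> fixes \<open>w 0\<close>, ...,
      \<open>w t\<close> and reverses \<open>e t\<close>.\<close>
    proof (rule vec_cond_exp_history_zero[OF w_meas _ rademacher_sequence_flip[of t]])
      show "integrable rademacher_sequence (e t)"
        by (rule integrable_const_bound[OF _ e_meas]) (auto simp: e_norm)
    qed (auto simp: w_past e_def flip_def)
  qed
  then show thesis
    using F_norm e_norm by (rule that)
qed

section \<open>Linear convergence\<close>

text \<open>An induction along the recursion gives the bound \<open>L * r ^ T\<close>. The
  contraction contributes the fraction \<open>q\<^sup>2\<close> of it, and the noise must fit into
  the remaining \<open>r - q\<^sup>2\<close>.\<close>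

lemma converges_linearly_error_bound:
  assumes c: "\<And>t. 0 \<le> c t" and q: "q < 1" "\<And>t. c t \<le> q" and \<alpha>: "converges_linearly \<alpha>"
  shows "converges_linearly (error_bound c \<alpha> wstar w0)"
proof -
  let ?E = "error_bound c \<alpha> wstar w0"
  obtain C M \<rho> where C: "C > 0" and \<rho>: "0 < \<rho>" "\<rho> < 1" and le: "\<And>T. T \<ge> M \<Longrightarrow> \<alpha> T \<le> C * \<rho> ^ T"
    and \<alpha>0: "\<And>T. 0 \<le> \<alpha> T"
    using \<alpha> unfolding converges_linearly_def by blast
  have q0: "0 \<le> q" using c[of 0] q(2)[of 0] by linarith
  \<comment> \<open>The midpoint between 1 and the larger of the two squared rates: strictly above
    \<open>q\<^sup>2\<close>, at least \<open>\<rho>\<^sup>2\<close>, and below 1.\<close>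
  define r where "r = (1 + max (q\<^sup>2) (\<rho>\<^sup>2)) / 2"
  have "q\<^sup>2 < 1" "\<rho>\<^sup>2 < 1"
    using q0 q \<rho> by (auto simp: power_less_one_iff)
  then have r: "q\<^sup>2 < r" "\<rho>\<^sup>2 \<le> r" "0 < r" "r < 1"
    unfolding r_def by (auto simp: max_def intro: add_pos_nonneg)
  \<comment> \<open>The three entries serve positivity, the base case at \<open>M\<close>, and the
    absorption of the noise in the induction step.\<close>
  define L where "L = max 1 (max (?E M / r ^ M) (C\<^sup>2 / (r - q\<^sup>2)))"
  have "?E T \<le> L * r ^ T" if "T \<ge> M" for T
    using that
  proof (induction T rule: dec_induct)
    case base
    have "?E M / r ^ M \<le> L" by (simp add: L_def)
    then show ?case using r by (simp add: field_simps)
  next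
    case (step T)
    have "C\<^sup>2 / (r - q\<^sup>2) \<le> L" by (simp add: L_def)
    then have CL: "C\<^sup>2 \<le> L * (r - q\<^sup>2)" using r by (simp add: field_simps)
    have "(\<alpha> T)\<^sup>2 \<le> (C * \<rho> ^ T)\<^sup>2"
      using le[of T] \<alpha>0 step by (intro power_mono) auto
    also have "\<dots> = C\<^sup>2 * (\<rho>\<^sup>2) ^ T"
      by (simp add: power_mult_distrib power_mult[symmetric] mult.commute)
    also have "\<dots> \<le> C\<^sup>2 * r ^ T"
      using r by (intro mult_left_mono power_mono) auto
    also have "\<dots> \<le> L * (r - q\<^sup>2) * r ^ T"
      using r CL by (intro mult_right_mono) auto
    finally have 1: "(\<alpha> T)\<^sup>2 \<le> L * (r - q\<^sup>2) * r ^ T" .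
    have "(c T)\<^sup>2 * ?E T \<le> q\<^sup>2 * (L * r ^ T)"
      using c q step error_bound_nonneg by (intro mult_mono power_mono) auto
    with 1 have "?E (Suc T) \<le> q\<^sup>2 * (L * r ^ T) + L * (r - q\<^sup>2) * r ^ T"
      unfolding error_bound_Suc by linarith
    then show ?case by (simp add: algebra_simps)
  qed
  moreover have "L > 0" by (simp add: L_def less_max_iff_disj)
  ultimately show ?thesis
    unfolding converges_linearly_def using r error_bound_nonneg by blast
qed

text \<open>By the recursion, \<open>(\<alpha> T)\<^sup>2\<close> is at most the bound at
  \<open>Suc T\<close>. Taking roots gives the rate \<open>sqrt \<rho>\<close>, and the index shift
  puts an extra \<open>\<rho>\<close> into the constant.\<close>

lemma converges_linearly_noise:
  assumes \<alpha>: "\<And>t. 0 \<le> \<alpha> t" and E: "converges_linearly (error_bound c \<alpha> wstar w0)"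
  shows "converges_linearly \<alpha>"
proof -
  let ?E = "error_bound c \<alpha> wstar w0"
  obtain C M \<rho> where C: "C > 0" and \<rho>: "0 < \<rho>" "\<rho> < 1" and le: "\<And>T. T \<ge> M \<Longrightarrow> ?E T \<le> C * \<rho> ^ T"
    using E unfolding converges_linearly_def by blast
  have "\<alpha> T \<le> sqrt (C * \<rho>) * sqrt \<rho> ^ T" if "T \<ge> M" for T
  proof -
    have "(\<alpha> T)\<^sup>2 \<le> ?E (Suc T)"
      by (simp add: error_bound_Suc error_bound_nonneg)
    also have "\<dots> \<le> C * \<rho> * \<rho> ^ T"
      using le[of "Suc T"] that by (simp add: mult_ac)
    finally have "\<alpha> T \<le> sqrt (C * \<rho> * \<rho> ^ T)"
      by (rule real_le_rsqrt)
    then show ?thesis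
      by (simp add: real_sqrt_mult real_sqrt_power)
  qed
  moreover have "0 < sqrt (C * \<rho>)" "0 < sqrt \<rho>" "sqrt \<rho> < 1"
    using C \<rho> by auto
  ultimately show ?thesis
    unfolding converges_linearly_def using \<alpha> by blast
qed

text \<open>Otherwise the bound would eventually decay no faster than \<open>r ^ k\<close> for some
  \<open>r\<close> above its assumed rate \<open>\<rho>\<close>. This is impossible once it is
  positive.\<close>

lemma bounded_away_from_1:
  assumes c: "\<And>t. 0 \<le> c t" "incseq c"
    and nz: "\<exists>\<^sub>F T in sequentially. error_bound c \<alpha> wstar w0 T \<noteq> 0"
    and E: "converges_linearly (error_bound c \<alpha> wstar w0)"
  shows "\<exists>q<1. \<forall>t. c t \<le> q"
proof (rule ccontr)
  assume unbounded: "\<not> (\<exists>q<1. \<forall>t. c t \<le> q)"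
  let ?E = "error_bound c \<alpha> wstar w0"
  obtain C M \<rho> where C: "C > 0" and \<rho>: "0 < \<rho>" "\<rho> < 1" and le: "\<And>T. T \<ge> M \<Longrightarrow> ?E T \<le> C * \<rho> ^ T"
    using E unfolding converges_linearly_def by blast
  obtain r where r: "\<rho> < r" "r < 1" using dense[OF \<rho>(2)] by blast
  \<comment> \<open>The recursion contains the square of \<open>c t\<close>, so \<open>c t\<close>
    is compared with the root of \<open>r\<close>. Monotonicity extends the comparison from
    \<open>N\<close> to all later indices.\<close>
  have "sqrt r < 1" using r by simp
  then obtain N where N: "sqrt r < c N"
    using unbounded by (meson not_le)
  have cr: "r \<le> (c t)\<^sup>2" if "t \<ge> N" for t
  proof -
    have "sqrt r \<le> c t" using N incseqD[OF c(2) that] by linarith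
    then show ?thesis using r \<rho> by (metis real_sqrt_le_iff real_sqrt_abs abs_of_nonneg c(1))
  qed
  \<comment> \<open>Nonvanishing infinitely often supplies an index beyond both thresholds at which
    the bound is positive.\<close>
  obtain T where T: "T \<ge> max M N" "?E T \<noteq> 0"
    using nz unfolding frequently_sequentially by blast
  then have ET: "?E T > 0" using error_bound_nonneg[of c \<alpha> wstar w0 T] by linarith
  have lower: "r ^ k * ?E T \<le> ?E (T + k)" for k
  proof (induction k)
    case (Suc k)
    have "r ^ Suc k * ?E T = r * (r ^ k * ?E T)" by simp
    also have "\<dots> \<le> (c (T + k))\<^sup>2 * ?E (T + k)"
      using Suc cr T r \<rho> ET by (intro mult_mono) auto
    also have "\<dots> \<le> ?E (T + Suc k)" by (simp add: error_bound_Suc)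
    finally show ?case .
  qed simp
  have upper: "(r / \<rho>) ^ k \<le> C * \<rho> ^ T / ?E T" for k
  proof -
    have "r ^ k * ?E T \<le> C * \<rho> ^ (T + k)"
      using lower[of k] le[of "T + k"] T by simp
    then show ?thesis
      using ET \<rho> by (simp add: power_divide field_simps power_add)
  qed
  obtain k where "C * \<rho> ^ T / ?E T < (r / \<rho>) ^ k"
    using real_arch_pow[of "r / \<rho>"] r \<rho> by auto
  with upper[of k] show False by simp
qed

text \<open>Integrability accompanies the inequality because a Bochner integral defaults to 0 for
  non-integrable functions. The equivalence is stated for bounds that are not eventually zero; the
  two implications after it hold without this restriction. In the sharp example the noise bound
  holds at every point.\<close>

theorem theorem2p4:
  fixes c \<alpha> :: "nat \<Rightarrow> real" and wstar w0 :: "real^'n"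
  assumes c_range: "\<And>t. 0 \<le> c t \<and> c t < 1"
    and \<alpha>_nonneg: "\<And>t. 0 \<le> \<alpha> t"
  shows
    "(\<forall>(M :: 'a measure) F e w. noisy_iteration M F c \<alpha> wstar w0 e w \<longrightarrow>
        (\<forall>T. integrable M (\<lambda>\<omega>. (norm (w T \<omega> - wstar))\<^sup>2) \<and>
             (\<integral>\<omega>. (norm (w T \<omega> - wstar))\<^sup>2 \<partial>M) \<le> error_bound c \<alpha> wstar w0 T))
     \<and>
     (\<exists>(M :: (nat \<Rightarrow> real) measure) F e w. noisy_iteration M F c \<alpha> wstar w0 e w \<and>
        (\<forall>t. \<forall>\<omega>\<in>space M. norm (e t \<omega>) \<le> \<alpha> t) \<and>
        (\<forall>T. (\<integral>\<omega>. (norm (w T \<omega> - wstar))\<^sup>2 \<partial>M) = error_bound c \<alpha> wstar w0 T))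
     \<and>
     (incseq c \<longrightarrow>
        ((\<exists>\<^sub>F T in sequentially. error_bound c \<alpha> wstar w0 T \<noteq> 0) \<longrightarrow>
           (converges_linearly (error_bound c \<alpha> wstar w0) \<longleftrightarrow>
              (\<exists>q<1. \<forall>t. c t \<le> q) \<and> converges_linearly \<alpha>)) \<and>
        ((\<exists>q<1. \<forall>t. c t \<le> q) \<and> converges_linearly \<alpha> \<longrightarrow>
           converges_linearly (error_bound c \<alpha> wstar w0)) \<and>
        (converges_linearly (error_bound c \<alpha> wstar w0) \<longrightarrow> converges_linearly \<alpha>))"
proof (intro conjI impI)
  show "\<forall>(M :: 'a measure) F e w. noisy_iteration M F c \<alpha> wstar w0 e w \<longrightarrow>
      (\<forall>T. integrable M (\<lambda>\<omega>. (norm (w T \<omega> - wstar))\<^sup>2) \<and>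
           (\<integral>\<omega>. (norm (w T \<omega> - wstar))\<^sup>2 \<partial>M) \<le> error_bound c \<alpha> wstar w0 T)"
    by (intro allI impI conjI noisy_iteration.integrable_error noisy_iteration.error_le)
next
  obtain M :: "(nat \<Rightarrow> real) measure" and F e w where
    it: "noisy_iteration M F c \<alpha> wstar w0 e w"
    and F: "\<And>t v. norm (F t v - wstar) = c t * norm (v - wstar)"
    and e: "\<And>t \<omega>. norm (e t \<omega>) = \<alpha> t"
    by (rule sharp_noisy_iteration[of c \<alpha> wstar w0, OF c_range \<alpha>_nonneg]) (rule that)
  show "\<exists>(M :: (nat \<Rightarrow> real) measure) F e w. noisy_iteration M F c \<alpha> wstar w0 e w \<and>
      (\<forall>t. \<forall>\<omega>\<in>space M. norm (e t \<omega>) \<le> \<alpha> t) \<and>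
      (\<forall>T. (\<integral>\<omega>. (norm (w T \<omega> - wstar))\<^sup>2 \<partial>M) = error_bound c \<alpha> wstar w0 T)"
    by (rule exI[of _ M], rule exI[of _ F], rule exI[of _ e], rule exI[of _ w])
      (simp add: it e noisy_iteration.error_eq[OF it F e])
next
  assume "incseq c" "\<exists>\<^sub>F T in sequentially. error_bound c \<alpha> wstar w0 T \<noteq> 0"
  then show "converges_linearly (error_bound c \<alpha> wstar w0) \<longleftrightarrow>
      (\<exists>q<1. \<forall>t. c t \<le> q) \<and> converges_linearly \<alpha>"
    using bounded_away_from_1[of c \<alpha> wstar w0] converges_linearly_noise[of \<alpha> c wstar w0]
      converges_linearly_error_bound[of c _ \<alpha> wstar w0] c_range \<alpha>_nonneg by blast
next
  assume "(\<exists>q<1. \<forall>t. c t \<le> q) \<and> converges_linearly \<alpha>"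
  then show "converges_linearly (error_bound c \<alpha> wstar w0)"
    using converges_linearly_error_bound[of c _ \<alpha> wstar w0] c_range by blast
next
  assume "converges_linearly (error_bound c \<alpha> wstar w0)"
  then show "converges_linearly \<alpha>"
    using converges_linearly_noise[of \<alpha> c wstar w0] \<alpha>_nonneg by blast
qed

end
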